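(* Let $M\subset\mathbb{C}^9$ be the real submanifold of codimension $5$ through $0$ given, in the coordinates $(z,w)=(z_1,\dots,z_4,w_1,\dots,w_5)\in\mathbb{C}^9$, by $$\begin{cases}\mathrm{Im}\,w_1=z_1\overline{z_2}+z_2\overline{z_1}\\ \mathrm{Im}\,w_2=-i z_1\overline{z_2}+i z_2\overline{z_1}\\ \mathrm{Im}\,w_3=z_3\overline{z_2}+z_4\overline{z_1}+z_2\overline{z_3}+z_1\overline{z_4}\\ \mathrm{Im}\,w_4=z_1\overline{z_1}\\ \mathrm{Im}\,w_5=z_2\overline{z_2}.\end{cases}$$ Then $M$ is Levi generating at $0$ (that is, of finite type at $0$ with $2$ the only Hörmander number), and its Levi map at $0$ is non-degenerate.
   Context: Let $M\subset\mathbb{C}^N$ be a generic real submanifold and $p\in M$. Let $T^{1,0}M$ and $T^{0,1}M=\overline{T^{1,0}M}$ be the bundles of $(1,0)$ and $(0,1)$ vectors tangent to $M$. The Levi map at $p$ is the map $\mathcal{L}_p:T^{1,0}_pM\times T^{1,0}_pM\to (\mathbb{C}\otimes T_pM)/(T^{1,0}_pM\oplus T^{0,1}_pM)$ given by $\mathcal{L}_p(A_p,B_p)=\frac{1}{2i}[A,\overline{B}]_p \bmod (T^{1,0}_pM\oplus T^{0,1}_pM)$, where $A,B$ are local sections of $T^{1,0}M$ extending $A_p,B_p$. It is non-degenerate if the only $A_p\in T^{1,0}_pM$ with $\mathcal{L}_p(A_p,B_p)=0$ for all $B_p\in T^{1,0}_pM$ is $A_p=0$. $M$ is Levi generating at $p$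 (of finite type with $2$ the only Hörmander number) if sections of $T^{1,0}M\oplus T^{0,1}M$ together with their Lie brackets of length two, evaluated at $p$, span $\mathbb{C}\otimes T_pM$ (where $M$ has positive codimension). *)

theory Defs
  imports "HOL-Analysis.Analysis"
begin

primrec Ck_on :: "nat \<Rightarrow> 'a::euclidean_space set \<Rightarrow> ('a \<Rightarrow> 'b::real_normed_vector) \<Rightarrow> bool" where
  "Ck_on 0 U f \<longleftrightarrow> continuous_on U f"
| "Ck_on (Suc n) U f \<longleftrightarrow>
     (\<forall>x\<in>U. f differentiable (at x)) \<and> (\<forall>v. Ck_on n U (\<lambda>x. frechet_derivative f (at x) v))"

definition smooth_on :: "'a::euclidean_space set \<Rightarrow> ('a \<Rightarrow> 'b::real_normed_vector) \<Rightarrow> bool" where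
  "smooth_on U f \<longleftrightarrow> open U \<and> (\<forall>n. Ck_on n U f)"

definition dz :: "'n::finite \<Rightarrow> (complex^'n \<Rightarrow> complex) \<Rightarrow> complex^'n \<Rightarrow> complex" where
  "dz j f q = (frechet_derivative f (at q) (axis j 1) - \<i> * frechet_derivative f (at q) (axis j \<i>)) / 2"

definition dzbar :: "'n::finite \<Rightarrow> (complex^'n \<Rightarrow> complex) \<Rightarrow> complex^'n \<Rightarrow> complex" where
  "dzbar j f q = (frechet_derivative f (at q) (axis j 1) + \<i> * frechet_derivative f (at q) (axis j \<i>)) / 2"

text \<open>A generic submanifold of codimension \<open>d\<close> is locally the zero set of \<open>d\<close> smooth real
  functions whose differentials \<open>\<partial>\<rho>\<^sub>0, \<dots>, \<partial>\<rho>\<^sub>d\<^sub>-\<^sub>1\<close> are linearly independent over the complex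
  numbers; in particular the real differentials are linearly independent over the reals.\<close>

definition generic_submanifold :: "nat \<Rightarrow> (complex^'n::finite) set \<Rightarrow> bool" where
  "generic_submanifold d M \<longleftrightarrow>
     (\<forall>p\<in>M. \<exists>U (\<rho> :: nat \<Rightarrow> complex^'n \<Rightarrow> real).
        open U \<and> p \<in> U \<and> (\<forall>j<d. smooth_on U (\<rho> j)) \<and>
        M \<inter> U = {q\<in>U. \<forall>j<d. \<rho> j q = 0} \<and>
        (\<forall>q\<in>U. \<forall>c :: nat \<Rightarrow> complex.
           (\<forall>k. (\<Sum>j<d. c j * dz k (\<lambda>x. complex_of_real (\<rho> j x)) q) = 0) \<longrightarrow> (\<forall>j<d. c j = 0)))"

text \<open>A real tangent vector of the ambient space is an element of \<^typ>\<open>complex^'n\<close>.\<close>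

definition tangent_space :: "(complex^'n::finite) set \<Rightarrow> complex^'n \<Rightarrow> (complex^'n) set" where
  "tangent_space M p =
     {v. \<exists>\<epsilon>>0. \<exists>\<gamma> :: real \<Rightarrow> complex^'n.
        smooth_on {-\<epsilon><..<\<epsilon>} \<gamma> \<and> \<gamma> ` {-\<epsilon><..<\<epsilon>} \<subseteq> M \<and> \<gamma> 0 = p \<and> (\<gamma> has_vector_derivative v) (at 0)}"

text \<open>A complexified tangent vector of the ambient space is written in the basis
  \<open>\<partial>/\<partial>z\<^sub>j, \<partial>/\<partial>z\<^sub>j-bar\<close>: the component at \<^term>\<open>Inl j\<close> is the coefficient of \<open>\<partial>/\<partial>z\<^sub>j\<close>, the one
  at \<^term>\<open>Inr j\<close> the coefficient of \<open>\<partial>/\<partial>z\<^sub>j-bar\<close>.\<close>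

type_synonym 'n ctangent = "complex^('n + 'n)"

definition of_real_tangent :: "complex^'n::finite \<Rightarrow> 'n ctangent" where
  "of_real_tangent v = (\<chi> k. case k of Inl j \<Rightarrow> v $ j | Inr j \<Rightarrow> cnj (v $ j))"

definition conj_tangent :: "'n::finite ctangent \<Rightarrow> 'n ctangent" where
  "conj_tangent v = (\<chi> k. case k of Inl j \<Rightarrow> cnj (v $ Inr j) | Inr j \<Rightarrow> cnj (v $ Inl j))"

text \<open>The complexification of the tangent space, as a complex subspace of that of the ambient
  space.\<close>

definition CT :: "(complex^'n::finite) set \<Rightarrow> complex^'n \<Rightarrow> 'n ctangent set" where
  "CT M p = vec.span (of_real_tangent ` tangent_space M p)"

definition T10 :: "(complex^'n::finite) set \<Rightarrow> complex^'n \<Rightarrow> 'n ctangent set" where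
  "T10 M p = {v \<in> CT M p. \<forall>j. v $ Inr j = 0}"

definition T01 :: "(complex^'n::finite) set \<Rightarrow> complex^'n \<Rightarrow> 'n ctangent set" where
  "T01 M p = conj_tangent ` T10 M p"

definition T10_plus_T01 :: "(complex^'n::finite) set \<Rightarrow> complex^'n \<Rightarrow> 'n ctangent set" where
  "T10_plus_T01 M p = {a + b | a b. a \<in> T10 M p \<and> b \<in> T01 M p}"

text \<open>Complex vector fields on \<open>M\<close> near \<open>p\<close> are represented by smooth extensions to an ambient
  neighbourhood of \<open>p\<close>; only the values on \<open>M\<close> are required to lie in the bundle. For fields
  tangent to \<open>M\<close>, the values of the ambient bracket on \<open>M\<close> do not depend on the extensions.\<close>

definition local_section ::
    "((complex^'n::finite) set \<Rightarrow> complex^'n \<Rightarrow> 'n ctangent set) \<Rightarrow> (complex^'n) set \<Rightarrow> complex^'n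
      \<Rightarrow> (complex^'n \<Rightarrow> 'n ctangent) \<Rightarrow> bool" where
  "local_section E M p X \<longleftrightarrow> (\<exists>U. p \<in> U \<and> smooth_on U X \<and> (\<forall>q\<in>M \<inter> U. X q \<in> E M q))"

definition vf_apply ::
    "(complex^'n::finite \<Rightarrow> 'n ctangent) \<Rightarrow> (complex^'n \<Rightarrow> complex) \<Rightarrow> complex^'n \<Rightarrow> complex" where
  "vf_apply X f q = (\<Sum>j\<in>UNIV. X q $ Inl j * dz j f q + X q $ Inr j * dzbar j f q)"

definition lie_bracket ::
    "(complex^'n::finite \<Rightarrow> 'n ctangent) \<Rightarrow> (complex^'n \<Rightarrow> 'n ctangent) \<Rightarrow> complex^'n \<Rightarrow> 'n ctangent"
  where
  "lie_bracket X Y q = (\<chi> k. vf_apply X (\<lambda>x. Y x $ k) q - vf_apply Y (\<lambda>x. X x $ k) q)"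

text \<open>Elements of the quotient of \<^term>\<open>CT M p\<close> by \<^term>\<open>T10_plus_T01 M p\<close> are cosets, so the
  zero element is \<^term>\<open>T10_plus_T01 M p\<close> itself.\<close>

definition levi_map ::
    "(complex^'n::finite) set \<Rightarrow> complex^'n \<Rightarrow> 'n ctangent \<Rightarrow> 'n ctangent \<Rightarrow> 'n ctangent set" where
  "levi_map M p a b =
     (THE C. \<exists>A B. local_section T10 M p A \<and> local_section T10 M p B \<and> A p = a \<and> B p = b \<and>
        C = (\<lambda>h. (1 / (2 * \<i>)) *s lie_bracket A (\<lambda>x. conj_tangent (B x)) p + h) ` T10_plus_T01 M p)"

definition levi_nondegenerate_at :: "(complex^'n::finite) set \<Rightarrow> complex^'n \<Rightarrow> bool" where
  "levi_nondegenerate_at M p \<longleftrightarrow>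
     (\<forall>a\<in>T10 M p. (\<forall>b\<in>T10 M p. levi_map M p a b = T10_plus_T01 M p) \<longrightarrow> a = 0)"

definition levi_generating_at :: "(complex^'n::finite) set \<Rightarrow> complex^'n \<Rightarrow> bool" where
  "levi_generating_at M p \<longleftrightarrow>
     (\<exists>d>0. generic_submanifold d M) \<and> p \<in> M \<and>
     vec.span ({X p | X. local_section T10_plus_T01 M p X} \<union>
       {lie_bracket X Y p | X Y. local_section T10_plus_T01 M p X \<and> local_section T10_plus_T01 M p Y})
     = CT M p"

text \<open>Coordinates \<open>1, \<dots>, 4\<close> are \<open>z\<^sub>1, \<dots>, z\<^sub>4\<close> and coordinates \<open>5, \<dots>, 9\<close> are
  \<open>w\<^sub>1, \<dots>, w\<^sub>5\<close>; in the index type, \<open>9 = 0\<close>.\<close>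

definition M9 :: "(complex^9) set" where
  "M9 = {x. let z1 = x $ 1; z2 = x $ 2; z3 = x $ 3; z4 = x $ 4;
               w1 = x $ 5; w2 = x $ 6; w3 = x $ 7; w4 = x $ 8; w5 = x $ 9
           in of_real (Im w1) = z1 * cnj z2 + z2 * cnj z1 \<and>
              of_real (Im w2) = - \<i> * z1 * cnj z2 + \<i> * z2 * cnj z1 \<and>
              of_real (Im w3) = z3 * cnj z2 + z4 * cnj z1 + z2 * cnj z3 + z1 * cnj z4 \<and>
              of_real (Im w4) = z1 * cnj z1 \<and>
              of_real (Im w5) = z2 * cnj z2}"

end

theory Submission
  imports Defs
begin

text \<open>For a quadric \<open>Im w = h(z, z)\<close> with \<open>h\<close> Hermitian, a function vanishing on the quadric is
  annihilated by every complex tangent vector. Applied to the equations which say that a vector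
  field is tangent (respectively of type \<open>(1,0)\<close>), this gives at the origin that brackets of tangent
  fields are tangent and that the \<open>w\<close>-components of \<open>[A, B-bar]\<close> equal \<open>-2i h(A\<^sub>0, B\<^sub>0)\<close>, whatever
  the extensions. So the Levi map at the origin is \<open>-h\<close>, and the claim becomes linear algebra: the
  values of \<open>h\<close> span the \<open>w\<close>-space, and \<open>h\<close> has trivial kernel.\<close>

section \<open>Smoothness of quadratic maps\<close>

text \<open>A directional derivative of such a map is affine in \<open>x\<close>, hence again of
  this form with zero bilinear part. The induction therefore lets \<open>c\<close>, \<open>L\<close>
  and \<open>B\<close> vary.\<close>

lemma Ck_on_quadratic:
  fixes L :: "'a::euclidean_space \<Rightarrow> 'b::real_normed_vector"
  assumes "bounded_linear L" "bounded_bilinear B"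
  shows "Ck_on n U (\<lambda>x. c + L x + B x x)"
  using assms
proof (induction n arbitrary: c L B)
  case 0
  interpret L: bounded_linear L by fact
  interpret B: bounded_bilinear B by fact
  show ?case
    by (auto intro!: continuous_intros L.continuous_on B.continuous_on)
next
  case (Suc n)
  interpret L: bounded_linear L by fact
  interpret B: bounded_bilinear B by fact
  have deriv: "((\<lambda>x. c + L x + B x x) has_derivative (\<lambda>v. L v + (B x v + B v x))) (at x)" for x
    by (auto intro!: derivative_eq_intros L.has_derivative B.FDERIV)
  have "Ck_on n U (\<lambda>x. L v + (B x v + B v x) + 0)" for v
    by (rule Suc.IH)
      (auto intro!: bounded_linear_add B.bounded_linear_left B.bounded_linear_right
         bounded_bilinear.intro exI[of _ 0])
  moreover have "frechet_derivative (\<lambda>x. c + L x + B x x) (at x) v = L v + (B x v + B v x)" for x v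
    by (simp add: frechet_derivative_at[OF deriv, symmetric])
  moreover have "(\<lambda>x. c + L x + B x x) differentiable (at x)" for x
    using deriv[of x] by (rule differentiableI)
  ultimately show ?case
    by simp
qed

lemma smooth_on_quadratic:
  fixes L :: "'a::euclidean_space \<Rightarrow> 'b::real_normed_vector"
  assumes "open U" "bounded_linear L" "bounded_bilinear B"
  shows "smooth_on U (\<lambda>x. c + L x + B x x)"
  using assms Ck_on_quadratic by (auto simp: smooth_on_def)

lemma smooth_on_affine:
  fixes L :: "'a::euclidean_space \<Rightarrow> 'b::real_normed_vector"
  assumes "open U" "bounded_linear L"
  shows "smooth_on U (\<lambda>x. c + L x)"
proof -
  have "bounded_bilinear (\<lambda>(x::'a) (y::'a). 0::'b)"
    by (auto intro!: bounded_bilinear.intro exI[of _ 0])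
  from smooth_on_quadratic[OF assms this] show ?thesis by simp
qed

lemma smooth_on_has_derivative:
  assumes "smooth_on U f" "x \<in> U"
  shows "(f has_derivative frechet_derivative f (at x)) (at x)"
proof -
  have "Ck_on (Suc 0) U f" using assms(1) unfolding smooth_on_def by blast
  then have "f differentiable (at x)" using assms(2) by simp
  then show ?thesis by (simp add: frechet_derivative_works)
qed

section \<open>Complexified tangent vectors as pairs of vectors\<close>

definition hol :: "'n::finite ctangent \<Rightarrow> complex^'n" where
  "hol v = (\<chi> j. v $ Inl j)"

text \<open>The conjugation makes \<open>ahol\<close> antilinear; in exchange, real vectors are
  those with \<open>hol v = ahol v\<close>.\<close>

definition ahol :: "'n::finite ctangent \<Rightarrow> complex^'n" where
  "ahol v = (\<chi> j. cnj (v $ Inr j))"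

text \<open>The vector \<open>ctan x y\<close> is \<open>\<Sum> x\<^sub>j \<partial>/\<partial>z\<^sub>j + \<Sum> y\<^sub>j-bar \<partial>/\<partial>z\<^sub>j-bar\<close>. It is real exactly if
  \<open>x = y\<close>, and conjugation swaps \<open>x\<close> and \<open>y\<close>.\<close>

definition ctan :: "complex^'n::finite \<Rightarrow> complex^'n \<Rightarrow> 'n ctangent" where
  "ctan x y = (\<chi> k. case k of Inl j \<Rightarrow> x $ j | Inr j \<Rightarrow> cnj (y $ j))"

lemma ctan_nth [simp]: "ctan x y $ Inl j = x $ j" "ctan x y $ Inr j = cnj (y $ j)"
  by (simp_all add: ctan_def)

lemma hol_nth [simp]: "hol v $ j = v $ Inl j" and ahol_nth [simp]: "ahol v $ j = cnj (v $ Inr j)"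
  by (simp_all add: hol_def ahol_def)

lemma ctangent_eq_iff: "v = w \<longleftrightarrow> hol v = hol w \<and> ahol v = ahol w"
proof -
  have "v = w" if "\<forall>j. v $ Inl j = w $ Inl j" "\<forall>j. v $ Inr j = w $ Inr j"
    unfolding vec_eq_iff using that by (metis sum.exhaust)
  then show ?thesis by (auto simp: vec_eq_iff)
qed

lemma hol_ctan [simp]: "hol (ctan x y) = x" and ahol_ctan [simp]: "ahol (ctan x y) = y"
  by (simp_all add: vec_eq_iff)

lemma hol_linear [simp]:
  "hol 0 = 0" "hol (v + w) = hol v + hol w" "hol (v - w) = hol v - hol w" "hol (c *s v) = c *s hol v"
  by (simp_all add: vec_eq_iff)

lemma ahol_antilinear [simp]:
  "ahol 0 = 0" "ahol (v + w) = ahol v + ahol w" "ahol (v - w) = ahol v - ahol w"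
  "ahol (c *s v) = cnj c *s ahol v"
  by (simp_all add: vec_eq_iff)

lemma of_real_tangent_eq_ctan: "of_real_tangent x = ctan x x"
  by (simp add: of_real_tangent_def ctan_def)

lemma hol_conj_tangent [simp]: "hol (conj_tangent v) = ahol v"
  and ahol_conj_tangent [simp]: "ahol (conj_tangent v) = hol v"
  by (simp_all add: vec_eq_iff conj_tangent_def)

lemma conj_tangent_nth [simp]:
  "conj_tangent v $ Inl j = cnj (v $ Inr j)" "conj_tangent v $ Inr j = cnj (v $ Inl j)"
  by (simp_all add: conj_tangent_def)

lemma conj_tangent_ctan [simp]: "conj_tangent (ctan x y) = ctan y x"
  by (simp add: ctangent_eq_iff)

lemma bounded_linear_hol: "bounded_linear hol"
  unfolding linear_conv_bounded_linear[symmetric]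
  by (rule linearI) (simp_all add: vec_eq_iff)

lemma bounded_linear_ahol: "bounded_linear ahol"
  unfolding linear_conv_bounded_linear[symmetric]
  by (rule linearI) (simp_all add: vec_eq_iff)

lemma bounded_linear_conj_tangent: "bounded_linear conj_tangent"
  unfolding linear_conv_bounded_linear[symmetric]
  by (rule linearI) (simp_all add: ctangent_eq_iff vec_eq_iff)

section \<open>Derivatives along complexified vectors\<close>

text \<open>The complex linear extension of a real linear form from real tangent vectors to complexified
  ones.\<close>

definition cderiv :: "(complex^'n::finite \<Rightarrow> complex) \<Rightarrow> 'n ctangent \<Rightarrow> complex" where
  "cderiv L v = (\<Sum>j\<in>UNIV. v $ Inl j * ((L (axis j 1) - \<i> * L (axis j \<i>)) / 2) +
                            v $ Inr j * ((L (axis j 1) + \<i> * L (axis j \<i>)) / 2))"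

lemma vf_apply_eq_cderiv:
  assumes "(f has_derivative L) (at p)"
  shows "vf_apply X f p = cderiv L (X p)"
  by (simp add: vf_apply_def cderiv_def dz_def dzbar_def frechet_derivative_at[OF assms, symmetric])

lemma cderiv_diff: "cderiv (\<lambda>u. L u - L' u) v = cderiv L v - cderiv L' v"
  unfolding cderiv_def sum_subtractf[symmetric]
  by (rule sum.cong) (auto simp: field_simps)

lemma subspace_cderiv_eq_0: "vec.subspace {v. cderiv L v = 0}"
proof -
  have "cderiv L (v + w) = cderiv L v + cderiv L w" for v w
    unfolding cderiv_def sum.distrib[symmetric]
    by (rule sum.cong) (auto simp: field_simps)
  moreover have "cderiv L (c *s v) = c * cderiv L v" for c v
    unfolding cderiv_def sum_distrib_left
    by (rule sum.cong) (auto simp: field_simps)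
  moreover have "cderiv L 0 = 0" by (simp add: cderiv_def)
  ultimately show ?thesis by (auto simp: vec.subspace_def)
qed

text \<open>A real linear map splits into a complex linear part, which acts on \<open>hol v\<close>,
  and an antilinear part, which acts on \<open>ahol v\<close>. This allows \<open>cderiv\<close> to
  be evaluated on sesquilinear maps without coordinates.\<close>

lemma cderiv_eq:
  assumes "linear L"
  shows "cderiv L v = (L (hol v) - \<i> * L (\<i> *s hol v) + (L (ahol v) + \<i> * L (\<i> *s ahol v))) / 2"
proof -
  interpret linear L by fact
  have expand: "L x = (\<Sum>j\<in>UNIV. Re (x $ j) * L (axis j 1) + Im (x $ j) * L (axis j \<i>))" for x
  proof -
    have "x = (\<Sum>j\<in>UNIV. Re (x $ j) *\<^sub>R axis j 1 + Im (x $ j) *\<^sub>R axis j \<i>)"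
      by (simp add: vec_eq_iff axis_def complex_eq_iff if_distrib[of "(*) _"] if_distrib[of Re] if_distrib[of Im] cong: if_cong)
    then have "L x = L (\<Sum>j\<in>UNIV. Re (x $ j) *\<^sub>R axis j 1 + Im (x $ j) *\<^sub>R axis j \<i>)" by simp
    also have "\<dots> = (\<Sum>j\<in>UNIV. Re (x $ j) * L (axis j 1) + Im (x $ j) * L (axis j \<i>))"
      unfolding sum add scale by (simp add: scaleR_conv_of_real)
    finally show ?thesis .
  qed
  \<comment> \<open>With \<open>A = L (axis j 1)\<close> and \<open>B = L (axis j \<i>)\<close>, the
    identities \<open>holo\<close> (for \<open>z = v $ Inl j\<close>) and \<open>anti\<close> (for
    \<open>z = v $ Inr j\<close>) match the two sides summand by summand.\<close>
  have holo: "of_real (Re z) * A + of_real (Im z) * B - \<i> * (of_real (Re (\<i> * z)) * A + of_real (Im (\<i> * z)) * B)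
      = z * (A - \<i> * B)" for z A B :: complex
    by (cases z) (simp add: complex_eq_iff algebra_simps)
  have anti: "of_real (Re (cnj z)) * A + of_real (Im (cnj z)) * B
      + \<i> * (of_real (Re (\<i> * cnj z)) * A + of_real (Im (\<i> * cnj z)) * B)
      = z * (A + \<i> * B)" for z A B :: complex
    by (cases z) (simp add: complex_eq_iff algebra_simps)
  show ?thesis
    unfolding expand[of "hol v"] expand[of "ahol v"] expand[of "_ *s _"] cderiv_def
    unfolding sum_distrib_left sum.distrib[symmetric] sum_subtractf[symmetric] sum_divide_distrib
      hol_nth ahol_nth vector_smult_component holo anti
    by (intro sum.cong) (auto simp: field_simps)
qed

lemma cderiv_of_real_tangent:
  assumes "linear L"
  shows "cderiv L (of_real_tangent x) = L x"
  by (simp add: cderiv_eq[OF assms] of_real_tangent_eq_ctan)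

section \<open>Functions vanishing on a set and its tangent vectors\<close>

text \<open>Along a curve in \<open>M\<close> through \<open>p\<close>, the composite with
  \<open>f\<close> is zero for small times, and the chain rule computes its derivative as
  \<open>L v\<close>.\<close>

lemma derivative_along_tangent_eq_0:
  fixes f :: "complex^'n::finite \<Rightarrow> 'b::real_normed_vector"
  assumes f: "(f has_derivative L) (at p)" and U: "open U" "p \<in> U" "\<And>q. q \<in> M \<inter> U \<Longrightarrow> f q = 0"
    and v: "v \<in> tangent_space M p"
  shows "L v = 0"
proof -
  obtain \<epsilon> \<gamma> where \<epsilon>: "\<epsilon> > 0" and sm: "smooth_on {-\<epsilon><..<\<epsilon>} \<gamma>" and img: "\<gamma> ` {-\<epsilon><..<\<epsilon>} \<subseteq> M"
    and \<gamma>0: "\<gamma> 0 = p" and \<gamma>: "(\<gamma> has_vector_derivative v) (at 0)"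
    using v unfolding tangent_space_def by blast
  have "continuous_on {-\<epsilon><..<\<epsilon>} \<gamma>"
    using sm unfolding smooth_on_def by (metis Ck_on.simps(1))
  then have "open (\<gamma> -` U \<inter> {-\<epsilon><..<\<epsilon>})"
    using U(1) by (simp add: continuous_on_open_vimage)
  moreover have "((f \<circ> \<gamma>) has_vector_derivative L v) (at 0)"
    using vector_derivative_diff_chain_within[of \<gamma> v 0 UNIV f L] \<gamma> f \<gamma>0
    by (auto intro: has_derivative_at_withinI)
  ultimately have "((\<lambda>_. 0::'b) has_vector_derivative L v) (at 0)"
    by (elim has_vector_derivative_transform_within_open) (use \<epsilon> \<gamma>0 U img in auto)
  then show ?thesis
    using vector_derivative_unique_at has_vector_derivative_const by blast
qed

text \<open>The kernel of \<open>cderiv L\<close> is a complex subspace that contains the real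
  tangent vectors, hence also their complex span.\<close>

lemma cderiv_along_CT_eq_0:
  fixes f :: "complex^'n::finite \<Rightarrow> complex"
  assumes f: "(f has_derivative L) (at p)" and U: "open U" "p \<in> U" "\<And>q. q \<in> M \<inter> U \<Longrightarrow> f q = 0"
    and v: "v \<in> CT M p"
  shows "cderiv L v = 0"
proof -
  have "linear L" using f by (rule has_derivative_linear)
  then have "of_real_tangent ` tangent_space M p \<subseteq> {v. cderiv L v = 0}"
    using derivative_along_tangent_eq_0[OF f U(1,2), of M] U(3) by (auto simp: cderiv_of_real_tangent)
  then have "CT M p \<subseteq> {v. cderiv L v = 0}"
    unfolding CT_def by (rule vec.span_minimal) (rule subspace_cderiv_eq_0)
  then show ?thesis using v by blast
qed

lemma subspace_CT: "vec.subspace (CT M p)"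
  unfolding CT_def by (rule vec.subspace_span)

lemma local_section_mono:
  assumes "local_section E M p X" "\<And>q. q \<in> M \<Longrightarrow> E M q \<subseteq> E' M q"
  shows "local_section E' M p X"
  using assms unfolding local_section_def by blast

text \<open>The bracket at \<open>p\<close> depends only on the values and first derivatives of the
  fields at \<open>p\<close>, so differentiated identities can determine it.\<close>

lemma lie_bracket_nth:
  assumes X: "(X has_derivative X') (at p)" and Y: "(Y has_derivative Y') (at p)"
  shows "lie_bracket X Y p $ k = cderiv (\<lambda>u. Y' u $ k) (X p) - cderiv (\<lambda>u. X' u $ k) (Y p)"
  unfolding lie_bracket_def
  using vf_apply_eq_cderiv[OF bounded_linear.has_derivative[OF bounded_linear_vec_nth X], of Y k]
    vf_apply_eq_cderiv[OF bounded_linear.has_derivative[OF bounded_linear_vec_nth Y], of X k]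
  by simp

lemma scaleR_eq_smult: "r *\<^sub>R x = of_real r *s (x :: complex^'n)"
  unfolding vec_eq_iff vector_scaleR_component vector_smult_component by (simp add: scaleR_conv_of_real)

section \<open>Hermitian quadrics and their sesquilinear form\<close>

text \<open>The coordinates in \<open>W\<close> are the \<open>w\<close>-coordinates, the others the \<open>z\<close>-coordinates.\<close>

locale hermitian_quadric =
  fixes W :: "'n::finite set" and h :: "complex^'n \<Rightarrow> complex^'n \<Rightarrow> complex^'n"
  assumes add_left: "h (x + x') y = h x y + h x' y"
    and scale_left: "h (c *s x) y = c *s h x y"
    and herm: "h y x $ k = cnj (h x y $ k)"
    and outside: "k \<notin> W \<Longrightarrow> h x y $ k = 0"
    and cong_left: "(\<And>k. k \<notin> W \<Longrightarrow> x $ k = x' $ k) \<Longrightarrow> h x y = h x' y"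
begin

text \<open>By \<open>herm\<close> the value \<open>h q q $ k\<close> is real, so \<open>Re\<close>
  only changes its type.\<close>

definition Q :: "(complex^'n) set" where
  "Q = {q. \<forall>k\<in>W. Im (q $ k) = Re (h q q $ k)}"

lemma add_right: "h x (y + y') = h x y + h x y'"
proof -
  have "h x (y + y') $ k = (h x y + h x y') $ k" for k
    by (simp add: herm[of x] add_left)
  then show ?thesis by (simp add: vec_eq_iff)
qed

lemma scale_right: "h x (c *s y) = cnj c *s h x y"
proof -
  have "h x (c *s y) $ k = (cnj c *s h x y) $ k" for k
    by (simp add: herm[of x] scale_left)
  then show ?thesis by (simp add: vec_eq_iff)
qed

lemma cong_right:
  assumes "\<And>k. k \<notin> W \<Longrightarrow> y $ k = y' $ k" shows "h x y = h x y'"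
proof -
  have "h x y $ k = h x y' $ k" for k
    using cong_left[OF assms] by (simp add: herm[of x])
  then show ?thesis by (simp add: vec_eq_iff)
qed

lemma scaleR_left: "h (r *\<^sub>R x) y = r *\<^sub>R h x y"
  and scaleR_right: "h x (r *\<^sub>R y) = r *\<^sub>R h x y"
  by (simp_all add: scaleR_eq_smult scale_left scale_right)

text \<open>Sesquilinear over the complex numbers, \<open>h\<close> is bilinear over the reals; this
  supplies the product rule.\<close>

sublocale h: bounded_bilinear h
  unfolding bilinear_conv_bounded_bilinear[symmetric] bilinear_def
  by (auto intro!: linearI simp: add_left add_right scaleR_left scaleR_right)

lemma h_shift_left: "(\<And>k. k \<notin> W \<Longrightarrow> u $ k = 0) \<Longrightarrow> h (x + u) y = h x y"
  by (rule cong_left) simp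

lemma h_shift_right: "(\<And>k. k \<notin> W \<Longrightarrow> u $ k = 0) \<Longrightarrow> h x (y + u) = h x y"
  by (rule cong_right) simp

lemma zero_in_Q: "0 \<in> Q"
  by (simp add: Q_def h.zero_left)

lemma rho_has_derivative:
  "((\<lambda>q. Im (q $ k) - Re (h q q $ k)) has_derivative
     (\<lambda>v. Im (v $ k) - Re (h v q $ k + h q v $ k))) (at q)"
  by (auto intro!: derivative_eq_intros h.FDERIV bounded_linear.has_derivative[OF bounded_linear_vec_nth])

section \<open>Genericity of the quadric\<close>

text \<open>Since \<open>h\<close> ignores the coordinates in \<open>W\<close>, the holomorphic
  derivatives of the defining functions in the \<open>w\<close>-directions form
  \<open>- \<i> / 2\<close> times the identity matrix, which forces independence at every
  point.\<close>

lemma generic_Q: "generic_submanifold (card W) Q"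
  unfolding generic_submanifold_def
proof (rule ballI)
  fix p :: "complex^'n"
  obtain e where e: "bij_betw e {0..<card W} W"
    using ex_bij_betw_nat_finite[of W] by auto
  define \<rho> where "\<rho> j q = Im (q $ e j) - Re (h q q $ e j)" for j q
  have smooth: "smooth_on UNIV (\<rho> j)" for j
  proof -
    have "bounded_linear (\<lambda>q::complex^'n. Im (q $ e j))"
      by (intro bounded_linear_compose[OF bounded_linear_Im] bounded_linear_vec_nth)
    moreover have "bounded_bilinear (\<lambda>q r. - Re (h q r $ e j))"
      unfolding bilinear_conv_bounded_bilinear[symmetric] bilinear_def
      by (auto intro!: linearI simp: add_left add_right scaleR_left scaleR_right)
    ultimately have "smooth_on UNIV (\<lambda>q. 0 + Im (q $ e j) + - Re (h q q $ e j))"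
      by (intro smooth_on_quadratic) auto
    then show ?thesis by (simp add: \<rho>_def[abs_def])
  qed
  have Q_eq: "Q = {q. \<forall>j<card W. \<rho> j q = 0}"
    using e unfolding bij_betw_def Q_def \<rho>_def by force
  have indep: "c i = 0"
    if sum0: "\<And>k. (\<Sum>j<card W. c j * dz k (\<lambda>x. complex_of_real (\<rho> j x)) q) = 0" and i: "i < card W" for q c i
  proof -
    have D: "((\<lambda>x. complex_of_real (\<rho> j x)) has_derivative
        (\<lambda>v. complex_of_real (Im (v $ e j) - Re (h v q $ e j + h q v $ e j)))) (at q)" for j
      unfolding \<rho>_def by (rule bounded_linear.has_derivative[OF bounded_linear_of_real rho_has_derivative])
    have eW: "e j \<in> W" if "j < card W" for j
      using e that by (auto simp: bij_betw_def)
    have h0: "h (axis (e i) s) x = 0" "h x (axis (e i) s) = 0" for s x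
    proof -
      have "axis (e i) s $ k = 0 $ k" if "k \<notin> W" for k
        using eW[OF i] that by (auto simp: axis_def)
      then show "h (axis (e i) s) x = 0" "h x (axis (e i) s) = 0"
        using cong_left[of "axis (e i) s" 0] cong_right[of "axis (e i) s" 0]
        by (simp_all add: h.zero_left h.zero_right)
    qed
    \<comment> \<open>The constant comes from \<open>Im w = (w - cnj w) / (2 * \<i>)\<close>; the
      \<open>h\<close>-terms contribute nothing by \<open>h0\<close>.\<close>
    have "dz (e i) (\<lambda>x. complex_of_real (\<rho> j x)) q = (if j = i then - \<i> / 2 else 0)"
      if "j < card W" for j
    proof -
      have "axis (e i) s $ e j = (if j = i then s else 0)" for s :: complex
        using e i that by (auto simp: axis_def bij_betw_def inj_on_def)
      then show ?thesis
        by (simp add: dz_def frechet_derivative_at[OF D, symmetric] h0)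
    qed
    then have "(\<Sum>j<card W. c j * dz (e i) (\<lambda>x. complex_of_real (\<rho> j x)) q)
        = (\<Sum>j<card W. if j = i then c j * (- \<i> / 2) else 0)"
      by (intro sum.cong) auto
    then show ?thesis using sum0[of "e i"] i by simp
  qed
  have "(\<forall>k. (\<Sum>j<card W. c j * dz k (\<lambda>x. complex_of_real (\<rho> j x)) q) = 0) \<longrightarrow> (\<forall>j<card W. c j = 0)"
    for q c
    by (intro impI allI) (rule indep[of c q], blast+)
  then have "open (UNIV :: (complex^'n) set) \<and> p \<in> UNIV \<and> (\<forall>j<card W. smooth_on UNIV (\<rho> j)) \<and>
        Q \<inter> UNIV = {q\<in>UNIV. \<forall>j<card W. \<rho> j q = 0} \<and>
        (\<forall>q\<in>UNIV. \<forall>c :: nat \<Rightarrow> complex.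
           (\<forall>k. (\<Sum>j<card W. c j * dz k (\<lambda>x. complex_of_real (\<rho> j x)) q) = 0) \<longrightarrow> (\<forall>j<card W. c j = 0))"
    using smooth Q_eq by blast
  then show "\<exists>U (\<rho> :: nat \<Rightarrow> complex^'n \<Rightarrow> real).
        open U \<and> p \<in> U \<and> (\<forall>j<card W. smooth_on U (\<rho> j)) \<and>
        Q \<inter> U = {q\<in>U. \<forall>j<card W. \<rho> j q = 0} \<and>
        (\<forall>q\<in>U. \<forall>c :: nat \<Rightarrow> complex.
           (\<forall>k. (\<Sum>j<card W. c j * dz k (\<lambda>x. complex_of_real (\<rho> j x)) q) = 0) \<longrightarrow> (\<forall>j<card W. c j = 0))"
    by (intro exI)
qed

section \<open>Tangent bundles of the quadric\<close>

text \<open>Differentiating the defining equations gives one inclusion; for the other, an explicit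
  parabola inside the quadric has the prescribed velocity.\<close>

lemma tangent_space_Q:
  assumes q: "q \<in> Q"
  shows "tangent_space Q q = {v. \<forall>k\<in>W. Im (v $ k) = Re (h v q $ k + h q v $ k)}"
proof (intro set_eqI iffI)
  fix v assume v: "v \<in> tangent_space Q q"
  have "Im (v $ k) - Re (h v q $ k + h q v $ k) = 0" if "k \<in> W" for k
    by (rule derivative_along_tangent_eq_0[OF rho_has_derivative, of UNIV _ Q])
      (use that v in \<open>auto simp: Q_def\<close>)
  then show "v \<in> {v. \<forall>k\<in>W. Im (v $ k) = Re (h v q $ k + h q v $ k)}" by simp
next
  fix v assume "v \<in> {v. \<forall>k\<in>W. Im (v $ k) = Re (h v q $ k + h q v $ k)}"
  then have v: "Im (v $ k) = Re (h v q $ k + h q v $ k)" if "k \<in> W" for k using that by auto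
  \<comment> \<open>The quadratic correction \<open>t\<^sup>2 u\<close> keeps the line \<open>q + t v\<close> on the quadric.\<close>
  define u where "u = \<i> *s h v v"
  have u: "u $ k = 0" if "k \<notin> W" for k using that by (simp add: u_def outside)
  define \<gamma> :: "real \<Rightarrow> complex^'n" where "\<gamma> t = q + t *\<^sub>R v + (t * t) *\<^sub>R u" for t
  have "smooth_on {-1<..<1} \<gamma>"
    unfolding \<gamma>_def
  proof (rule smooth_on_quadratic[where B = "\<lambda>s t. (s * t) *\<^sub>R u"])
    show "bounded_linear (\<lambda>t. t *\<^sub>R v)" by (rule bounded_linear_scaleR_left)
    show "bounded_bilinear (\<lambda>s t. (s * t) *\<^sub>R u)"
      unfolding bilinear_conv_bounded_bilinear[symmetric] bilinear_def
      by (auto intro!: linearI simp: algebra_simps)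
  qed auto
  moreover have "\<gamma> t \<in> Q" for t
  proof -
    have "h (\<gamma> t) (\<gamma> t) = h (q + t *\<^sub>R v) (q + t *\<^sub>R v)"
      unfolding \<gamma>_def by (simp add: u h_shift_left[of "(t * t) *\<^sub>R u"] h_shift_right[of "(t * t) *\<^sub>R u"])
    also have "\<dots> = h q q + t *\<^sub>R (h v q + h q v) + (t * t) *\<^sub>R h v v"
      by (simp add: h.add_left h.add_right h.scaleR_left h.scaleR_right algebra_simps)
    \<comment> \<open>Compare powers of \<open>t\<close>: order zero is \<open>q \<in> Q\<close>,
      order one is the hypothesis on \<open>v\<close>, and order two holds because
      \<open>h v v\<close> is real and \<open>u = \<i> *s h v v\<close>.\<close>
    finally have "Re (h (\<gamma> t) (\<gamma> t) $ k) = Im (\<gamma> t $ k)" if "k \<in> W" for k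
      using v[OF that] q that by (simp add: \<gamma>_def u_def Q_def)
    then show ?thesis by (simp add: Q_def)
  qed
  moreover have "(\<gamma> has_vector_derivative v) (at 0)"
    unfolding \<gamma>_def by (auto intro!: derivative_eq_intros)
  moreover have "\<gamma> 0 = q" by (simp add: \<gamma>_def)
  ultimately show "v \<in> tangent_space Q q"
    unfolding tangent_space_def by (intro CollectI exI[of _ 1] exI[of _ \<gamma>]) auto
qed

text \<open>Conjugating the tangency equation exchanges the arguments of \<open>h\<close> by
  \<open>herm\<close>, and thereby the roles of \<open>hol v\<close> and
  \<open>ahol v\<close>.\<close>

lemma tangency_conj_tangent:
  assumes "v $ Inl k - v $ Inr k = 2 * \<i> * (h (hol v) q $ k + h q (ahol v) $ k)"
  shows "cnj (v $ Inr k) - cnj (v $ Inl k) = 2 * \<i> * (h (ahol v) q $ k + h q (hol v) $ k)"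
proof -
  have "cnj (v $ Inl k - v $ Inr k) = cnj (2 * \<i> * (h (hol v) q $ k + h q (ahol v) $ k))"
    using assms by simp
  then show ?thesis
    by (simp add: herm[of q "hol v"] herm[of "ahol v" q] algebra_simps)
qed

text \<open>The solution space is complex linear and stable under conjugation, so each solution is
  \<open>a + \<i> *s b\<close> with real solutions \<open>a\<close> and \<open>b\<close>, and these
  are tangent vectors.\<close>

lemma CT_Q:
  assumes q: "q \<in> Q"
  shows "CT Q q = {v. \<forall>k\<in>W. v $ Inl k - v $ Inr k = 2 * \<i> * (h (hol v) q $ k + h q (ahol v) $ k)}"
    (is "_ = ?T")
proof
  have sub: "vec.subspace ?T"
    by (auto simp: vec.subspace_def h.zero_left h.zero_right h.add_left h.add_right
        scale_left scale_right algebra_simps)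
  have real: "of_real_tangent x \<in> ?T \<longleftrightarrow> x \<in> tangent_space Q q" for x
  proof -
    \<comment> \<open>The left side is \<open>2 * \<i> * Im (x $ k)\<close>, and by
      \<open>herm\<close> the sum in brackets on the right is real.\<close>
    have "x $ k - cnj (x $ k) = 2 * \<i> * (h x q $ k + h q x $ k) \<longleftrightarrow> Im (x $ k) = Re (h x q $ k + h q x $ k)" for k
      by (subst (1 2) herm[of q]) (auto simp: complex_eq_iff)
    then show ?thesis by (simp add: tangent_space_Q[OF q] of_real_tangent_eq_ctan)
  qed
  show "CT Q q \<subseteq> ?T"
    unfolding CT_def by (rule vec.span_minimal[OF _ sub]) (use real in auto)
  show "?T \<subseteq> CT Q q"
  proof
    fix v assume v: "v \<in> ?T"
    \<comment> \<open>Real and imaginary part of \<open>v\<close> with respect to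
      \<open>conj_tangent\<close>.\<close>
    define a where "a = (1/2) *s (v + conj_tangent v)"
    define b where "b = (- \<i>/2) *s (v - conj_tangent v)"
    have cv: "conj_tangent v \<in> ?T"
      using v tangency_conj_tangent by simp
    have "a \<in> ?T" unfolding a_def by (intro vec.subspace_scale[OF sub] vec.subspace_add[OF sub] v cv)
    moreover have "b \<in> ?T" unfolding b_def by (intro vec.subspace_scale[OF sub] vec.subspace_diff[OF sub] v cv)
    moreover have "a = of_real_tangent (hol a)" "b = of_real_tangent (hol b)"
      by (auto simp: of_real_tangent_eq_ctan ctangent_eq_iff a_def b_def vec_eq_iff algebra_simps)
    ultimately have "a \<in> CT Q q" "b \<in> CT Q q"
      using real[of "hol a"] real[of "hol b"] unfolding CT_def by (metis vec.span_base imageI)+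
    moreover have "v = a + \<i> *s b"
      by (simp add: a_def b_def vec_eq_iff field_simps)
    ultimately show "v \<in> CT Q q"
      unfolding CT_def by (simp add: vec.span_add vec.span_scale)
  qed
qed

lemma T10_Q:
  assumes "q \<in> Q"
  shows "v \<in> T10 Q q \<longleftrightarrow> ahol v = 0 \<and> (\<forall>k\<in>W. v $ Inl k = 2 * \<i> * h (hol v) q $ k)"
proof -
  have ahol: "(\<forall>j. v $ Inr j = 0) \<longleftrightarrow> ahol v = 0" by (auto simp: vec_eq_iff)
  then have "v $ Inr j = 0" if "ahol v = 0" for j using that by blast
  then show ?thesis
    by (auto simp: T10_def CT_Q[OF assms] ahol h.zero_right)
qed

lemma conj_tangent_CT:
  assumes "q \<in> Q" "v \<in> CT Q q"
  shows "conj_tangent v \<in> CT Q q"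
  using assms tangency_conj_tangent by (simp add: CT_Q)

lemma T10_plus_T01_subset_CT:
  assumes "q \<in> Q"
  shows "T10_plus_T01 Q q \<subseteq> CT Q q"
  using conj_tangent_CT[OF assms]
  by (auto simp: T10_plus_T01_def T01_def T10_def intro: vec.subspace_add[OF subspace_CT])

lemma CT_Q_0: "v \<in> CT Q 0 \<longleftrightarrow> (\<forall>k\<in>W. v $ Inl k = v $ Inr k)"
  by (simp add: CT_Q[OF zero_in_Q] h.zero_left h.zero_right)

lemma T10_Q_0: "v \<in> T10 Q 0 \<longleftrightarrow> ahol v = 0 \<and> (\<forall>k\<in>W. v $ Inl k = 0)"
  by (simp add: T10_Q[OF zero_in_Q] h.zero_right)

lemma T10_plus_T01_Q_0: "v \<in> T10_plus_T01 Q 0 \<longleftrightarrow> (\<forall>k\<in>W. v $ Inl k = 0 \<and> v $ Inr k = 0)"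
proof
  assume "v \<in> T10_plus_T01 Q 0"
  then obtain a b where "v = a + conj_tangent b" "a \<in> T10 Q 0" "b \<in> T10 Q 0"
    by (auto simp: T10_plus_T01_def T01_def)
  then show "\<forall>k\<in>W. v $ Inl k = 0 \<and> v $ Inr k = 0"
    by (auto simp: T10_Q_0 vec_eq_iff)
next
  assume v: "\<forall>k\<in>W. v $ Inl k = 0 \<and> v $ Inr k = 0"
  have "v = ctan (hol v) 0 + conj_tangent (ctan (ahol v) 0)"
    by (simp add: ctangent_eq_iff)
  moreover have "ctan (hol v) 0 \<in> T10 Q 0" "ctan (ahol v) 0 \<in> T10 Q 0"
    using v by (auto simp: T10_Q_0)
  ultimately show "v \<in> T10_plus_T01 Q 0"
    unfolding T10_plus_T01_def T01_def by blast
qed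

section \<open>Sections extending given vectors at the origin\<close>

text \<open>An extension to a field of type \<open>(1,0) + (0,1)\<close> of its value \<open>ctan x y\<close> at the origin, for \<open>x\<close>, \<open>y\<close>
  without \<open>w\<close>-components.\<close>

definition lift :: "complex^'n \<Rightarrow> complex^'n \<Rightarrow> complex^'n \<Rightarrow> 'n ctangent" where
  "lift x y q = ctan (x + 2 * \<i> *s h x q) (y + 2 * \<i> *s h y q)"

lemma conj_lift: "(\<lambda>q. conj_tangent (lift x y q)) = lift y x"
  by (simp add: lift_def fun_eq_iff)

lemma lift_0: "lift x y 0 = ctan x y"
  by (simp add: lift_def h.zero_right)

lemma smooth_lift: "smooth_on UNIV (lift x y)"
proof -
  have "linear (\<lambda>q. ctan (2 * \<i> *s h x q) (2 * \<i> *s h y q))"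
    by (rule linearI)
      (simp_all add: ctangent_eq_iff vec_eq_iff add_right scaleR_right algebra_simps)
  then have "smooth_on UNIV (\<lambda>q. ctan x y + ctan (2 * \<i> *s h x q) (2 * \<i> *s h y q))"
    by (intro smooth_on_affine) (simp_all add: linear_conv_bounded_linear)
  moreover have "ctan x y + ctan (2 * \<i> *s h x q) (2 * \<i> *s h y q) = lift x y q" for q
    by (simp add: lift_def ctangent_eq_iff)
  ultimately show ?thesis by simp
qed

text \<open>The correction \<open>2 * \<i> *s h x q\<close> has components only in \<open>W\<close>,
  where \<open>h\<close> does not see it, and supplies exactly the \<open>w\<close>-components that
  \<open>T10_Q\<close> demands.\<close>

lemma lift_T10:
  assumes "q \<in> Q" "\<And>k. k \<in> W \<Longrightarrow> x $ k = 0"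
  shows "lift x 0 q \<in> T10 Q q"
  using h_shift_left[of "2 * \<i> *s h x q" x q] assms
  by (simp add: T10_Q lift_def h.zero_left outside)

lemma lift_T10_plus_T01:
  assumes "q \<in> Q" "\<And>k. k \<in> W \<Longrightarrow> x $ k = 0" "\<And>k. k \<in> W \<Longrightarrow> y $ k = 0"
  shows "lift x y q \<in> T10_plus_T01 Q q"
proof -
  have "lift x y q = lift x 0 q + conj_tangent (lift y 0 q)"
    by (simp add: lift_def ctangent_eq_iff h.zero_left)
  then show ?thesis
    using lift_T10[OF assms(1,2)] lift_T10[OF assms(1,3)]
    unfolding T10_plus_T01_def T01_def by blast
qed

lemma section_T10_lift:
  assumes "\<And>k. k \<in> W \<Longrightarrow> x $ k = 0"
  shows "local_section T10 Q 0 (lift x 0)"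
  unfolding local_section_def
  by (intro exI[of _ UNIV]) (simp add: smooth_lift lift_T10[OF _ assms])

lemma section_T10_plus_T01_lift:
  assumes "\<And>k. k \<in> W \<Longrightarrow> x $ k = 0" "\<And>k. k \<in> W \<Longrightarrow> y $ k = 0"
  shows "local_section T10_plus_T01 Q 0 (lift x y)"
  unfolding local_section_def
  by (intro exI[of _ UNIV]) (simp add: smooth_lift lift_T10_plus_T01[OF _ assms])

section \<open>Brackets at the origin\<close>

text \<open>Being complex linear in the first argument, \<open>h\<close> sees only the
  \<open>(1,0)\<close> part there; being antilinear in the second, it sees only the
  \<open>(0,1)\<close> part in the next lemma.\<close>

lemma cderiv_h_left: "cderiv (\<lambda>u. c * h u y $ k) v = c * h (hol v) y $ k"
proof -
  have "linear (\<lambda>u. c * h u y $ k)"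
    by (rule linearI) (simp_all add: add_left scaleR_left algebra_simps)
  then show ?thesis by (simp add: cderiv_eq scale_left algebra_simps)
qed

lemma cderiv_h_right: "cderiv (\<lambda>u. c * h x u $ k) v = c * h x (ahol v) $ k"
proof -
  have "linear (\<lambda>u. c * h x u $ k)"
    by (rule linearI) (simp_all add: add_right scaleR_right algebra_simps)
  then show ?thesis by (simp add: cderiv_eq scale_right algebra_simps)
qed

text \<open>Differentiates the tangency equation along \<open>v\<close>; the right-hand side is symmetric in \<open>X 0\<close> and
  \<open>v\<close>, which makes it cancel in brackets.\<close>

lemma cderiv_tangent_field:
  assumes X': "(X has_derivative X') (at 0)" and U: "open U" "0 \<in> U"
    and X: "\<And>q. q \<in> Q \<inter> U \<Longrightarrow> X q \<in> CT Q q" and v: "v \<in> CT Q 0" and k: "k \<in> W"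
  shows "cderiv (\<lambda>u. X' u $ Inl k) v - cderiv (\<lambda>u. X' u $ Inr k) v =
    2 * \<i> * (h (hol (X 0)) (ahol v) $ k + h (hol v) (ahol (X 0)) $ k)"
proof -
  note hX = bounded_linear.has_derivative[OF bounded_linear_hol X']
  note aX = bounded_linear.has_derivative[OF bounded_linear_ahol X']
  define f where "f q = X q $ Inl k - X q $ Inr k
      - (2 * \<i> * h (hol (X q)) q $ k) - (2 * \<i> * h q (ahol (X q)) $ k)" for q
  have "(f has_derivative (\<lambda>u. X' u $ Inl k - X' u $ Inr k
      - (2 * \<i> * (h (hol (X 0)) u + h (hol (X' u)) 0) $ k)
      - (2 * \<i> * (h 0 (ahol (X' u)) + h u (ahol (X 0))) $ k))) (at 0)"
    unfolding f_def
    by (intro has_derivative_diff has_derivative_mult_right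
        bounded_linear.has_derivative[OF bounded_linear_vec_nth] X' h.FDERIV hX aX has_derivative_ident)
  \<comment> \<open>At the origin the terms with \<open>X' u\<close> inside \<open>h\<close> drop
    out, since their other argument is the base point \<open>0\<close>.\<close>
  then have "(f has_derivative (\<lambda>u. X' u $ Inl k - X' u $ Inr k
      - (2 * \<i> * h (hol (X 0)) u $ k) - (2 * \<i> * h u (ahol (X 0)) $ k))) (at 0)"
    by (simp add: h.zero_left h.zero_right)
  moreover have "f q = 0" if "q \<in> Q \<inter> U" for q
    using X[OF that] that k by (simp add: f_def CT_Q algebra_simps)
  ultimately have "cderiv (\<lambda>u. X' u $ Inl k - X' u $ Inr k
      - (2 * \<i> * h (hol (X 0)) u $ k) - (2 * \<i> * h u (ahol (X 0)) $ k)) v = 0"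
    using U v by (intro cderiv_along_CT_eq_0[of f])
  then show ?thesis
    unfolding cderiv_diff cderiv_h_left cderiv_h_right by (simp add: algebra_simps)
qed

text \<open>Subtract the tangency equation of \<open>X\<close> differentiated along \<open>Y\<close>
  from that of \<open>Y\<close> differentiated along \<open>X\<close>: the right-hand sides
  cancel.\<close>

lemma lie_bracket_CT:
  assumes X: "local_section CT Q 0 X" and Y: "local_section CT Q 0 Y"
  shows "lie_bracket X Y 0 \<in> CT Q 0"
proof -
  obtain U V where U: "0 \<in> U" "smooth_on U X" "\<And>q. q \<in> Q \<inter> U \<Longrightarrow> X q \<in> CT Q q"
    and V: "0 \<in> V" "smooth_on V Y" "\<And>q. q \<in> Q \<inter> V \<Longrightarrow> Y q \<in> CT Q q"
    using X Y unfolding local_section_def by blast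
  have open_UV: "open U" "open V" using U(2) V(2) by (auto simp: smooth_on_def)
  note X' = smooth_on_has_derivative[OF U(2,1)] and Y' = smooth_on_has_derivative[OF V(2,1)]
  have at0: "X 0 \<in> CT Q 0" "Y 0 \<in> CT Q 0" using U V zero_in_Q by auto
  have "lie_bracket X Y 0 $ Inl k = lie_bracket X Y 0 $ Inr k" if "k \<in> W" for k
    using cderiv_tangent_field[OF X' open_UV(1) U(1,3) at0(2) that]
      cderiv_tangent_field[OF Y' open_UV(2) V(1,3) at0(1) that]
    unfolding lie_bracket_nth[OF X' Y'] by (simp add: algebra_simps)
  then show ?thesis by (simp add: CT_Q_0)
qed

text \<open>On the quadric \<open>A\<close> has no \<open>(0,1)\<close> components and the conjugate
  of \<open>B\<close> has no \<open>(1,0)\<close> components. So one of the two derivatives in each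
  bracket component vanishes, and the differentiated tangency equation determines the other.\<close>

lemma lie_bracket_T10_conj:
  assumes A: "local_section T10 Q 0 A" and B: "local_section T10 Q 0 B" and k: "k \<in> W"
  shows "lie_bracket A (\<lambda>q. conj_tangent (B q)) 0 $ Inl k = - 2 * \<i> * h (hol (A 0)) (hol (B 0)) $ k"
    and "lie_bracket A (\<lambda>q. conj_tangent (B q)) 0 $ Inr k = - 2 * \<i> * h (hol (A 0)) (hol (B 0)) $ k"
proof -
  let ?B = "\<lambda>q. conj_tangent (B q)"
  obtain U V where U: "0 \<in> U" "smooth_on U A" "\<And>q. q \<in> Q \<inter> U \<Longrightarrow> A q \<in> T10 Q q"
    and V: "0 \<in> V" "smooth_on V B" "\<And>q. q \<in> Q \<inter> V \<Longrightarrow> B q \<in> T10 Q q"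
    using A B unfolding local_section_def by blast
  have open_UV: "open U" "open V" using U(2) V(2) by (auto simp: smooth_on_def)
  define A' where "A' = frechet_derivative A (at 0)"
  define B' where "B' u = conj_tangent (frechet_derivative B (at 0) u)" for u
  have A': "(A has_derivative A') (at 0)"
    unfolding A'_def using smooth_on_has_derivative[OF U(2,1)] .
  have B': "(?B has_derivative B') (at 0)"
    unfolding B'_def
    using bounded_linear.has_derivative[OF bounded_linear_conj_tangent smooth_on_has_derivative[OF V(2,1)]] .
  have CT: "A q \<in> CT Q q" if "q \<in> Q \<inter> U" for q
    using U(3)[OF that] by (simp add: T10_def)
  have conjCT: "?B q \<in> CT Q q" if "q \<in> Q \<inter> V" for q
    using V(3)[OF that] that conj_tangent_CT by (auto simp: T10_def)
  have at0: "A 0 \<in> CT Q 0" "?B 0 \<in> CT Q 0" using CT conjCT U(1) V(1) zero_in_Q by auto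
  have zero: "cderiv (\<lambda>u. B' u $ Inl k) (A 0) = 0"
    by (rule cderiv_along_CT_eq_0[OF bounded_linear.has_derivative[OF bounded_linear_vec_nth B'] open_UV(2) V(1) _ at0(1)])
      (use V(3) in \<open>auto simp: T10_def\<close>)
  have zero': "cderiv (\<lambda>u. A' u $ Inr k) (?B 0) = 0"
    by (rule cderiv_along_CT_eq_0[OF bounded_linear.has_derivative[OF bounded_linear_vec_nth A'] open_UV(1) U(1) _ at0(2)])
      (use U(3) in \<open>auto simp: T10_def\<close>)
  have "A 0 \<in> T10 Q 0" "B 0 \<in> T10 Q 0" using U(1,3) V(1,3) zero_in_Q by auto
  then have "ahol (A 0) = 0" "ahol (B 0) = 0" by (simp_all add: T10_Q_0)
  then show "lie_bracket A ?B 0 $ Inl k = - 2 * \<i> * h (hol (A 0)) (hol (B 0)) $ k"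
    and "lie_bracket A ?B 0 $ Inr k = - 2 * \<i> * h (hol (A 0)) (hol (B 0)) $ k"
    using zero zero' cderiv_tangent_field[OF A' open_UV(1) U(1) CT at0(2) k]
      cderiv_tangent_field[OF B' open_UV(2) V(1) conjCT at0(1) k]
    unfolding lie_bracket_nth[OF A' B'] by (simp_all add: h.zero_left h.zero_right eq_neg_iff_add_eq_0 neg_eq_iff_add_eq_0)
qed

section \<open>The Levi map and the two conditions at the origin\<close>

text \<open>A coset of \<open>T10_plus_T01 Q 0\<close> is determined by its
  \<open>w\<close>-components, and those of the bracket are the same for all extensions;
  \<open>lift\<close> provides extensions, so the description in \<open>levi_map\<close> has a
  unique solution. The sign is \<open>(1 / (2 * \<i>)) * (- 2 * \<i>) = - 1\<close>.\<close>

lemma levi_map_Q: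
  assumes a: "a \<in> T10 Q 0" and b: "b \<in> T10 Q 0"
  shows "levi_map Q 0 a b =
    {v. \<forall>k\<in>W. v $ Inl k = - h (hol a) (hol b) $ k \<and> v $ Inr k = - h (hol a) (hol b) $ k}"
    (is "_ = ?C")
proof -
  have coset: "(\<lambda>s. (1 / (2 * \<i>)) *s lie_bracket A (\<lambda>q. conj_tangent (B q)) 0 + s) ` T10_plus_T01 Q 0 = ?C"
    if AB: "local_section T10 Q 0 A" "local_section T10 Q 0 B" "A 0 = a" "B 0 = b" for A B
  proof -
    define c where "c = (1 / (2 * \<i>)) *s lie_bracket A (\<lambda>q. conj_tangent (B q)) 0"
    have c: "c $ Inl k = - h (hol a) (hol b) $ k" "c $ Inr k = - h (hol a) (hol b) $ k" if "k \<in> W" for k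
      using lie_bracket_T10_conj[OF AB(1,2) that] AB(3,4) by (simp_all add: c_def)
    have "v \<in> (\<lambda>s. c + s) ` T10_plus_T01 Q 0 \<longleftrightarrow> v \<in> ?C" for v
    proof -
      have "v \<in> (\<lambda>s. c + s) ` T10_plus_T01 Q 0 \<longleftrightarrow> v - c \<in> T10_plus_T01 Q 0"
        by (metis (no_types, lifting) add_diff_cancel_left' diff_add_cancel add.commute image_iff)
      also have "\<dots> \<longleftrightarrow> v \<in> ?C" by (auto simp: T10_plus_T01_Q_0 c eq_neg_iff_add_eq_0)
      finally show ?thesis .
    qed
    then show ?thesis unfolding c_def by blast
  qed
  have sec: "\<exists>A. local_section T10 Q 0 A \<and> A 0 = x" if "x \<in> T10 Q 0" for x
  proof (intro exI conjI)
    show "local_section T10 Q 0 (lift (hol x) 0)"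
      using that by (intro section_T10_lift) (auto simp: T10_Q_0)
    show "lift (hol x) 0 0 = x"
      using that by (simp add: lift_0 ctangent_eq_iff T10_Q_0)
  qed
  show ?thesis
    unfolding levi_map_def
    by (rule the_equality) (use coset sec[OF a] sec[OF b] in blast)+
qed

lemma levi_nondegenerate_Q:
  assumes nd: "\<And>x. (\<And>k. k \<in> W \<Longrightarrow> x $ k = 0) \<Longrightarrow> (\<And>y. h x y = 0) \<Longrightarrow> x = 0"
  shows "levi_nondegenerate_at Q 0"
  unfolding levi_nondegenerate_at_def
proof (intro ballI impI)
  fix a assume a: "a \<in> T10 Q 0" and null: "\<forall>b\<in>T10 Q 0. levi_map Q 0 a b = T10_plus_T01 Q 0"
  have "h (hol a) y = 0" for y
  proof -
    \<comment> \<open>Deleting the \<open>w\<close>-components makes the vector admissible for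
      \<open>T10\<close> at the origin without changing \<open>h\<close>.\<close>
    define z where "z = (\<chi> k. if k \<in> W then 0 else y $ k)"
    have z: "ctan z 0 \<in> T10 Q 0" by (simp add: T10_Q_0 z_def)
    have "0 \<in> T10_plus_T01 Q 0" by (simp add: T10_plus_T01_Q_0)
    with null z have "0 \<in> levi_map Q 0 a (ctan z 0)" by blast
    then have "h (hol a) z $ k = 0" for k
      using outside by (cases "k \<in> W") (auto simp: levi_map_Q[OF a z])
    moreover have "h (hol a) y = h (hol a) z" by (rule cong_right) (simp add: z_def)
    ultimately show ?thesis by (simp add: vec_eq_iff)
  qed
  moreover have "hol a $ k = 0" if "k \<in> W" for k
    using a that by (simp add: T10_Q_0)
  ultimately have "hol a = 0" by (rule nd[rotated])
  then show "a = 0" using a by (simp add: ctangent_eq_iff T10_Q_0)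
qed

text \<open>Modulo \<open>T10_plus_T01 Q 0\<close>, a complexified tangent vector at the origin is
  determined by its \<open>w\<close>-part, and suitable brackets realize every value of
  \<open>h\<close> as such a part.\<close>

lemma levi_generating_Q:
  assumes W: "W \<noteq> {}" and span: "\<And>k. k \<in> W \<Longrightarrow> axis k 1 \<in> vec.span {h x y | x y. True}"
  shows "levi_generating_at Q 0"
proof -
  let ?S = "{X 0 | X. local_section T10_plus_T01 Q 0 X}"
  let ?B = "{lie_bracket X Y 0 | X Y. local_section T10_plus_T01 Q 0 X \<and> local_section T10_plus_T01 Q 0 Y}"
  let ?G = "vec.span (?S \<union> ?B)"
  have toCT: "local_section CT Q 0 X" if "local_section T10_plus_T01 Q 0 X" for X
    using local_section_mono[OF that] T10_plus_T01_subset_CT by blast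
  have "?G \<subseteq> CT Q 0"
  proof (rule vec.span_minimal[OF _ subspace_CT])
    have "X 0 \<in> CT Q 0" if "local_section T10_plus_T01 Q 0 X" for X
      using toCT[OF that] zero_in_Q by (auto simp: local_section_def)
    then show "?S \<union> ?B \<subseteq> CT Q 0" using lie_bracket_CT toCT by blast
  qed
  moreover have S: "v \<in> ?G" if "v \<in> T10_plus_T01 Q 0" for v
  proof -
    have "local_section T10_plus_T01 Q 0 (lift (hol v) (ahol v))"
      using that by (intro section_T10_plus_T01_lift) (auto simp: T10_plus_T01_Q_0)
    moreover have "lift (hol v) (ahol v) 0 = v" by (simp add: lift_0 ctangent_eq_iff)
    ultimately have "v \<in> ?S" by (metis (mono_tags, lifting) mem_Collect_eq)
    then show ?thesis by (intro vec.span_base UnI1)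
  qed
  \<comment> \<open>\<open>E\<close> puts the same coefficient on both conjugate basis vectors, as
    \<open>CT_Q_0\<close> requires on \<open>W\<close>; the \<open>cnj\<close> cancels the one in
    \<open>ctan\<close>, so \<open>E\<close> is complex linear.\<close>
  define E :: "complex^'n \<Rightarrow> 'n ctangent" where "E t = ctan t (\<chi> k. cnj (t $ k))" for t
  have E: "E 0 = 0" "E (s + t) = E s + E t" "E (c *s t) = c *s E t" for s t c
    by (auto simp: E_def ctangent_eq_iff vec_eq_iff)
  have sub: "vec.subspace {t. E t \<in> ?G}"
    by (auto simp: vec.subspace_def E vec.span_zero vec.span_add vec.span_scale)
  have "E (h x y) \<in> ?G" for x y
  proof -
    define x' y' where "x' = (\<chi> k. if k \<in> W then 0 else x $ k)" and "y' = (\<chi> k. if k \<in> W then 0 else y $ k)"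
    have W0: "x' $ k = 0" "y' $ k = 0" if "k \<in> W" for k using that by (auto simp: x'_def y'_def)
    have hxy: "h x y = h x' y'"
      using cong_left[of x x'] cong_right[of y y'] by (simp add: x'_def y'_def)
    have A: "local_section T10 Q 0 (lift x' 0)" "local_section T10 Q 0 (lift y' 0)"
      using W0 by (auto intro: section_T10_lift)
    let ?b = "lie_bracket (lift x' 0) (\<lambda>q. conj_tangent (lift y' 0 q)) 0"
    have "?b \<in> ?B"
      unfolding conj_lift using W0 section_T10_plus_T01_lift[of x' 0] section_T10_plus_T01_lift[of 0 y']
      by auto
    then have b: "(- 1 / (2 * \<i>)) *s ?b \<in> ?G" by (intro vec.span_scale vec.span_base UnI2)
    \<comment> \<open>The factor \<open>- 1 / (2 * \<i>)\<close> undoes the factor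
      \<open>- 2 * \<i>\<close> of the bracket formula, so the \<open>w\<close>-components of the
      difference vanish.\<close>
    have "E (h x y) - (- 1 / (2 * \<i>)) *s ?b \<in> T10_plus_T01 Q 0"
      using lie_bracket_T10_conj[OF A] by (simp add: T10_plus_T01_Q_0 E_def hxy lift_0)
    from vec.span_add[OF S[OF this] b] show ?thesis by simp
  qed
  then have "vec.span {h x y | x y. True} \<subseteq> {t. E t \<in> ?G}"
    by (intro vec.span_minimal[OF _ sub]) auto
  then have axis: "E (axis k 1) \<in> ?G" if "k \<in> W" for k using span[OF that] by blast
  have "v \<in> ?G" if v: "v \<in> CT Q 0" for v
  proof -
    define t where "t = (\<Sum>k\<in>W. (v $ Inl k) *s axis k (1::complex))"
    have "t \<in> {t. E t \<in> ?G}"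
      unfolding t_def using axis
      by (intro vec.subspace_sum[OF sub] vec.subspace_scale[OF sub]) simp
    then have t: "E t \<in> ?G" by simp
    have "t $ k = v $ Inl k" if "k \<in> W" for k
      using that by (simp add: t_def axis_def if_distrib cong: if_cong)
    then have "v - E t \<in> T10_plus_T01 Q 0"
      using v by (simp add: T10_plus_T01_Q_0 CT_Q_0 E_def)
    from vec.span_add[OF S[OF this] t] show ?thesis by simp
  qed
  ultimately have "?G = CT Q 0" by blast
  moreover have "card W > 0" using W by (simp add: card_gt_0_iff)
  ultimately show ?thesis
    unfolding levi_generating_at_def using generic_Q zero_in_Q by blast
qed

end

section \<open>The quadric of codimension five\<close>

text \<open>Polarization of the right-hand sides of the defining equations: each conjugated variable
  is taken from \<open>y\<close>.\<close>

definition h9 :: "complex^9 \<Rightarrow> complex^9 \<Rightarrow> complex^9" where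
  "h9 x y = (\<chi> k.
     if k = 5 then x $ 1 * cnj (y $ 2) + x $ 2 * cnj (y $ 1)
     else if k = 6 then - \<i> * x $ 1 * cnj (y $ 2) + \<i> * x $ 2 * cnj (y $ 1)
     else if k = 7 then x $ 3 * cnj (y $ 2) + x $ 4 * cnj (y $ 1) + x $ 2 * cnj (y $ 3) + x $ 1 * cnj (y $ 4)
     else if k = 8 then x $ 1 * cnj (y $ 1)
     else if k = 9 then x $ 2 * cnj (y $ 2)
     else 0)"

interpretation M9: hermitian_quadric "{5, 6, 7, 8, 9}" h9
  by standard (auto simp: h9_def vec_eq_iff algebra_simps)

text \<open>The right-hand sides are real by Hermitian symmetry, so the complex equations amount to
  equations between real parts.\<close>

lemma M9_eq: "M9 = M9.Q"
  unfolding M9_def M9.Q_def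
  by (auto simp: h9_def complex_eq_iff Let_def)

lemma UNIV_9: "UNIV = {1, 2, 3, 4, 5, 6, 7, 8, 9 :: 9}"
proof -
  have "card {1, 2, 3, 4, 5, 6, 7, 8, 9 :: 9} = CARD(9)" by simp
  then show ?thesis by (intro card_subset_eq[symmetric]) auto
qed

theorem proposition3:
  shows "generic_submanifold 5 M9 \<and> 0 \<in> M9 \<and> levi_generating_at M9 0 \<and> levi_nondegenerate_at M9 0"
proof (intro conjI)
  have "card {5, 6, 7, 8, 9 :: 9} = 5" by simp
  then show "generic_submanifold 5 M9" using M9.generic_Q unfolding M9_eq by metis
  show "0 \<in> M9" unfolding M9_eq by (rule M9.zero_in_Q)
  show "levi_nondegenerate_at M9 0"
    unfolding M9_eq
  proof (rule M9.levi_nondegenerate_Q)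
    fix x assume W: "\<And>k. k \<in> {5, 6, 7, 8, 9 :: 9} \<Longrightarrow> x $ k = 0" and null: "\<And>y. h9 x y = 0"
    \<comment> \<open>Pairing with the first basis vector gives \<open>x $ 4\<close> in component
      \<open>7\<close> and \<open>x $ 1\<close> in component \<open>8\<close>; pairing with the
      second gives \<open>x $ 3\<close> in component \<open>7\<close> and \<open>x $ 2\<close> in
      component \<open>9\<close>.\<close>
    have x1: "x $ 1 = 0" using null[of "axis 1 1"] by (auto simp: h9_def vec_eq_iff axis_def dest: spec[of _ 8])
    have x2: "x $ 2 = 0" using null[of "axis 2 1"] by (auto simp: h9_def vec_eq_iff axis_def dest: spec[of _ 9])
    have x3: "x $ 3 = 0" using null[of "axis 2 1"] by (auto simp: h9_def vec_eq_iff axis_def dest: spec[of _ 7])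
    have x4: "x $ 4 = 0" using null[of "axis 1 1"] by (auto simp: h9_def vec_eq_iff axis_def dest: spec[of _ 7])
    have "x $ k = 0" for k
      using UNIV_I[of k] W x1 x2 x3 x4 unfolding UNIV_9 by auto
    then show "x = 0" by (simp add: vec_eq_iff)
  qed
  show "levi_generating_at M9 0"
    unfolding M9_eq
  proof (rule M9.levi_generating_Q)
    let ?H = "vec.span {h9 x y | x y. True}"
    have H: "h9 (axis i 1) (axis j 1) \<in> ?H" for i j by (rule vec.span_base) blast
    \<comment> \<open>With \<open>e\<close> for the basis vectors,
      \<open>h9 e1 e2 = e5 - \<i> e6\<close> and \<open>h9 e2 e1 = e5 + \<i> e6\<close>; solving
      this pair gives \<open>e5\<close> and \<open>e6\<close>.\<close>
    have "axis 5 1 = (1/2) *s (h9 (axis 1 1) (axis 2 1) + h9 (axis 2 1) (axis 1 1))"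
      by (auto simp: h9_def vec_eq_iff axis_def)
    then have "axis 5 1 \<in> ?H" by (simp only: vec.span_scale vec.span_add H)
    moreover have "axis 6 1 = (\<i>/2) *s (h9 (axis 1 1) (axis 2 1) - h9 (axis 2 1) (axis 1 1))"
      by (auto simp: h9_def vec_eq_iff axis_def)
    then have "axis 6 1 \<in> ?H" by (simp only: vec.span_scale vec.span_diff H)
    moreover have "axis 7 1 = h9 (axis 3 1) (axis 2 1)" "axis 8 1 = h9 (axis 1 1) (axis 1 1)"
      "axis 9 1 = h9 (axis 2 1) (axis 2 1)"
      by (auto simp: h9_def vec_eq_iff axis_def)
    then have "axis 7 1 \<in> ?H" "axis 8 1 \<in> ?H" "axis 9 1 \<in> ?H" by (simp_all only: H)
    ultimately show "axis k 1 \<in> ?H" if "k \<in> {5, 6, 7, 8, 9}" for k using that by auto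
  qed simp
qed

end
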